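(* Let $G$ be a claw-free graph with $\delta(G)\geq \alpha(G)+1$. Then $G$ has a 2-factor with at most $\alpha(G)$ cycles.
   Context: All graphs are simple, finite, and undirected. A graph is claw-free if it contains no induced subgraph isomorphic to $K_{1,3}$. $\delta(G)$ denotes the minimum degree of $G$ and $\alpha(G)$ the independence number of $G$. A 2-factor of $G$ is a 2-regular spanning subgraph of $G$; it is a vertex-disjoint union of cycles (its components), and "at most $\alpha(G)$ cycles" means that it has at most $\alpha(G)$ components. *)

theory Defs
  imports "Graph_Theory.Graph_Theory"
begin

text \<open>
  Finite simple undirected graphs are the symmetric digraphs of the locale \<^locale>\<open>graph\<close>:
  finite, without loops, without parallel arcs, every edge being a pair of opposite arcs.
  The degree of a vertex is therefore its out-degree.
\<close>

text \<open>Unspecified for the null graph, which the locale \<^locale>\<open>graph\<close> admits.\<close>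

definition min_degree :: "('a, 'b) pre_digraph \<Rightarrow> nat" where
  "min_degree G = Min (out_degree G ` verts G)"

definition independent_set :: "('a, 'b) pre_digraph \<Rightarrow> 'a set \<Rightarrow> bool" where
  "independent_set G S \<longleftrightarrow> S \<subseteq> verts G \<and> (\<forall>u\<in>S. \<forall>v\<in>S. \<not> u \<rightarrow>\<^bsub>G\<^esub> v)"

definition independence_number :: "('a, 'b) pre_digraph \<Rightarrow> nat" where
  "independence_number G = Max (card ` {S. independent_set G S})"

definition claw_free :: "('a, 'b) pre_digraph \<Rightarrow> bool" where
  "claw_free G \<longleftrightarrow> \<not> (\<exists>H. induced_subgraph H G \<and> K\<^bsub>1,3\<^esub> H)"

definition regular :: "nat \<Rightarrow> ('a, 'b) pre_digraph \<Rightarrow> bool" where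
  "regular k G \<longleftrightarrow> (\<forall>v\<in>verts G. out_degree G v = k)"

text \<open>
  The conjunct \<^term>\<open>graph F\<close> is needed because \<^const>\<open>spanning\<close> also admits subdigraphs that
  contain only one of the two arcs of an edge.
\<close>

definition two_factor :: "('a, 'b) pre_digraph \<Rightarrow> ('a, 'b) pre_digraph \<Rightarrow> bool" where
  "two_factor F G \<longleftrightarrow> graph F \<and> spanning F G \<and> regular 2 F"

definition components :: "('a, 'b) pre_digraph \<Rightarrow> ('a, 'b) pre_digraph set" where
  "components G = {C. pre_digraph.max_subgraph G connected C}"

lemma components_eq_sccs:
  assumes "graph H"
  shows "components H = pre_digraph.sccs H"
proof -
  interpret graph H by fact
  have sc_induced: "strongly_connected (H \<restriction> verts C)" if "subgraph C H" "connected C" for C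
  proof -
    let ?I = "H \<restriction> verts C"
    have "induced_subgraph ?I H" using that by (auto intro: induced_induce)
    then interpret I: sym_digraph ?I by (rule induced_graph_imp_graph)
    have "spanning C ?I"
      using that subgraph_induce_subgraphI2 by (auto simp: spanning_def)
    then have "connected ?I"
      using that I.connected_spanning_imp_connected by blast
    then show ?thesis
      using I.sym_arcs I.symmetric_connected_imp_strongly_connected by blast
  qed
  have conn: "connected C" if "strongly_connected C" for C :: "('a, 'b) pre_digraph"
  proof -
    have "(u, v) \<in> rtrancl_on (verts C) ((arcs_ends C)\<^sup>s)"
      if "u \<rightarrow>\<^sup>*\<^bsub>C\<^esub> v" for u v
      using that unfolding reachable_def by (auto simp: symcl_def intro: rtrancl_on_mono[rotated 2])
    with that show ?thesis unfolding connected_conv strongly_connected_def by blast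
  qed
  have "max_subgraph strongly_connected C" if max: "max_subgraph connected C" for C
  proof -
    have sub: "subgraph C H" and "connected C" using max by (auto simp: max_subgraph_def)
    then have sc: "strongly_connected (H \<restriction> verts C)" by (rule sc_induced)
    have "C = H \<restriction> verts C"
      using max conn[OF sc] subgraph_induce_subgraphI2[OF sub]
        subgraph_induce_subgraphI[OF subgraph_imp_subverts[OF sub]]
      unfolding max_subgraph_def by metis
    then have "strongly_connected C" using sc by simp
    with max conn show ?thesis by (rule max_subgraph_mp)
  qed
  moreover have "max_subgraph connected C" if max: "max_subgraph strongly_connected C" for C
  proof (rule max_subgraphI)
    show "connected C" "subgraph C H" using max conn by (auto simp: max_subgraph_def)
    fix D assume D: "C \<noteq> D" "subgraph C D" "subgraph D H"
    show "\<not> connected D"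
    proof
      assume "connected D"
      with D have sc: "strongly_connected (H \<restriction> verts D)" by (auto intro: sc_induced)
      have "subgraph D (H \<restriction> verts D)" using D by (intro subgraph_induce_subgraphI2)
      moreover have "subgraph (H \<restriction> verts D) H"
        using D by (intro subgraph_induce_subgraphI subgraph_imp_subverts)
      ultimately have "C = H \<restriction> verts D"
        using max sc D subgraph_trans[of C D "H \<restriction> verts D"]
        unfolding max_subgraph_def by metis
      with \<open>subgraph D (H \<restriction> verts D)\<close> D show False
        by (auto simp: subgraph_def compatible_def)
    qed
  qed
  ultimately show ?thesis unfolding components_def sccs_altdef2 by blast
qed

end

theory Submission
  imports Defs "HOL-Library.Disjoint_Sets"
begin

text \<open>
  The 2-factor is peeled off greedily, one cycle at a time, because the hypothesis is inherited by
  what remains. Write \<open>\<alpha>(V)\<close> for the independence number of the subgraph induced on \<open>V\<close>, and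
  suppose that every vertex of \<open>V\<close> has more than \<open>\<alpha>(V)\<close> neighbours in \<open>V\<close>.

  The first vertex \<open>u\<close> of a longest path has all its neighbours on that path, so cutting the path
  after the last neighbour gives a cycle through \<open>u\<close> and all neighbours of \<open>u\<close>. Among
  the vertex sets that contain these vertices and carry a Hamiltonian cycle, let \<open>A\<close> be a largest
  one. Since \<open>u\<close> can be added to any independent subset of \<open>V - A\<close>, passing to \<open>V - A\<close> lowers
  \<open>\<alpha>\<close> by at least 1. A vertex \<open>d\<close> of \<open>V - A\<close> loses its \<open>m\<close> neighbours in \<open>A\<close>, so the degree
  hypothesis survives provided that \<open>\<alpha>\<close> drops by at least \<open>m\<close>. For \<open>m \<le> 1\<close> this has just
  been seen; for \<open>m \<ge> 2\<close> it is lemma \<open>alpha_drop\<close>, the heart of the proof. It exhibits \<open>m\<close>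
  pairwise nonadjacent vertices of \<open>A\<close> without any neighbour in \<open>V - A\<close>; these can be added to an
  independent subset of \<open>V - A\<close>.

  The \<open>m\<close> vertices are the successors of the neighbours of \<open>d\<close> on a suitable Hamiltonian cycle of
  \<open>A\<close>. Two such successors are never adjacent: otherwise the usual crossing argument would insert
  \<open>d\<close> into the cycle. To arrange that no successor has a neighbour outside \<open>A\<close>, claw-freeness is
  used. If a vertex \<open>x\<close> of the cycle has an outside neighbour \<open>s\<close>, then \<open>s\<close> is not adjacent to the
  cycle neighbours of \<open>x\<close> (else it could be inserted), so these two are adjacent to each other.
  Consequently two consecutive vertices that both have outside neighbours may trade places, and a
  neighbour of \<open>d\<close> can be moved along the cycle until its successor has no outside neighbour. It
  cannot run into another neighbour of \<open>d\<close> on the way, as \<open>d\<close> would fit between the two.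
\<close>

section \<open>Cycles and independent sets\<close>

locale adjacency =
  fixes adj :: "'a \<Rightarrow> 'a \<Rightarrow> bool"
  assumes adj_sym: "adj u v \<Longrightarrow> adj v u"
    and adj_irrefl: "\<not> adj u u"
begin

definition is_cycle :: "'a list \<Rightarrow> bool" where
  "is_cycle xs \<longleftrightarrow> 3 \<le> length xs \<and> distinct xs \<and> successively adj xs \<and> adj (last xs) (hd xs)"

definition has_hamiltonian_cycle :: "'a set \<Rightarrow> bool" where
  "has_hamiltonian_cycle A \<longleftrightarrow> (\<exists>xs. is_cycle xs \<and> set xs = A)"

definition indep :: "'a set \<Rightarrow> bool" where
  "indep I \<longleftrightarrow> (\<forall>u\<in>I. \<forall>v\<in>I. \<not> adj u v)"

definition alpha :: "'a set \<Rightarrow> nat" where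
  "alpha V = Max (card ` {I. I \<subseteq> V \<and> indep I})"

lemma is_cycle_rotate: "is_cycle (xs @ ys) \<Longrightarrow> is_cycle (ys @ xs)"
  by (cases "xs = []"; cases "ys = []") (auto simp: is_cycle_def successively_append_iff)

lemma adj_commute: "adj u v \<longleftrightarrow> adj v u"
  using adj_sym by blast

lemma successively_adj_rev: "successively (\<lambda>x y. adj y x) xs \<longleftrightarrow> successively adj xs"
  by (simp add: adj_commute)

lemma is_cycle_insert:
  assumes "is_cycle (p # q # zs)" "d \<notin> set (p # q # zs)" "adj d p" "adj d q"
  shows "is_cycle (p # d # q # zs)"
  using assms adj_sym by (auto simp: is_cycle_def)

text \<open>
  If the successors of two vertices on a cycle are adjacent, a common neighbour \<open>d\<close> of the two
  vertices can be inserted: run through one of the two arcs backwards, cross over to the other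
  arc, and return through \<open>d\<close>.
\<close>

lemma crossing_cycle:
  assumes "is_cycle (c # ys @ c' # ys')" "ys \<noteq> []" "ys' \<noteq> []"
    "d \<notin> set (c # ys @ c' # ys')" "adj d c" "adj d c'" "adj (hd ys) (hd ys')"
  shows "is_cycle (d # c # rev ys' @ ys @ [c'])"
proof -
  have "ys' = hd ys' # tl ys'" "ys = hd ys # tl ys" using assms by auto
  with assms show ?thesis
    by (auto simp: is_cycle_def successively_append_iff successively_adj_rev adj_sym
        hd_rev last_rev successively_Cons)
qed

lemma alpha_attained:
  assumes "finite V"
  obtains I where "I \<subseteq> V" "indep I" "card I = alpha V"
proof -
  have "finite {I. I \<subseteq> V \<and> indep I}" "{} \<in> {I. I \<subseteq> V \<and> indep I}"
    using assms by (auto simp: indep_def)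
  then have "alpha V \<in> card ` {I. I \<subseteq> V \<and> indep I}"
    unfolding alpha_def by (intro Max_in) auto
  then show ?thesis using that by auto
qed

lemma card_le_alpha:
  assumes "finite V" "I \<subseteq> V" "indep I"
  shows "card I \<le> alpha V"
  using assms unfolding alpha_def by (intro Max_ge) auto

text \<open>
  The first vertex \<open>u\<close> of a longest path has no neighbour off the path, so the initial segment that
  ends at the last neighbour of \<open>u\<close> closes up to a cycle.
\<close>

lemma cycle_around_neighbourhood:
  assumes fin: "finite V" and "V \<noteq> {}" and two: "\<And>v. v \<in> V \<Longrightarrow> 2 \<le> card {u \<in> V. adj v u}"
  shows "\<exists>u xs. is_cycle xs \<and> set xs \<subseteq> V \<and> u \<in> set xs \<and> {w \<in> V. adj u w} \<subseteq> set xs"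
proof -
  let ?P = "\<lambda>xs. xs \<noteq> [] \<and> distinct xs \<and> set xs \<subseteq> V \<and> successively adj xs"
  obtain v where "v \<in> V" using assms(2) by blast
  then have "?P [v]" by auto
  moreover have "\<forall>xs. ?P xs \<longrightarrow> length xs < Suc (card V)"
    using fin by (metis card_mono distinct_card le_imp_less_Suc)
  ultimately obtain p where p: "?P p" and longest: "\<forall>xs. ?P xs \<longrightarrow> length xs \<le> length p"
    using ex_has_greatest_nat[of ?P "[v]" length "Suc (card V)"] by blast
  define u where "u = hd p"
  have u: "u \<in> set p" "u \<in> V" using p by (auto simp: u_def)
  have nbrs: "w \<in> set p" if "w \<in> V" "adj u w" for w
  proof (rule ccontr)
    assume "w \<notin> set p"
    then have "?P (w # p)" using p that adj_sym by (auto simp: u_def successively_Cons)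
    then show False using longest by fastforce
  qed
  have "{w \<in> V. adj u w} \<noteq> {}" using two[OF u(2)] by (metis card.empty not_numeral_le_zero)
  then have "\<exists>x\<in>set p. adj u x" using nbrs by blast
  then obtain ys x zs where split: "p = ys @ x # zs" "adj u x" "\<forall>z\<in>set zs. \<not> adj u z"
    using split_list_last_prop[of p "adj u"] by blast
  let ?c = "ys @ [x]"
  have N: "{w \<in> V. adj u w} \<subseteq> set ?c" using nbrs split by auto
  have "u \<noteq> x" using split(2) adj_irrefl by blast
  then have "ys \<noteq> []" and hd_ys: "hd ys = u" using split(1) u_def by (cases ys; auto)+
  then have u_in: "u \<in> set ?c" by auto
  have "insert u {w \<in> V. adj u w} \<subseteq> set ?c" using N u_in by blast
  then have "card (insert u {w \<in> V. adj u w}) \<le> length ?c"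
    by (meson card_length card_mono finite_set le_trans)
  moreover have "card (insert u {w \<in> V. adj u w}) = Suc (card {w \<in> V. adj u w})"
    using fin adj_irrefl by (intro card_insert_disjoint) auto
  ultimately have "3 \<le> length ?c" using two[OF u(2)] by simp
  then have "is_cycle ?c"
    using p split hd_ys \<open>ys \<noteq> []\<close> adj_sym by (auto simp: is_cycle_def successively_append_iff)
  moreover have "set ?c \<subseteq> V" using p split by auto
  ultimately show ?thesis using N u_in by blast
qed

text \<open>
  Both orientations of every edge occur, so that the pairs can be taken as the arcs of a symmetric
  digraph.
\<close>

definition cycle_edges :: "'a list \<Rightarrow> ('a \<times> 'a) set" where
  "cycle_edges xs = set (zip xs (rotate1 xs)) \<union> (set (zip xs (rotate1 xs)))\<inverse>"

lemma cycle_edges_sym: "sym (cycle_edges xs)"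
  by (auto simp: cycle_edges_def sym_def)

lemma cycle_edges_rotate: "cycle_edges (xs @ ys) = cycle_edges (ys @ xs)"
proof -
  have "set (zip (xs @ ys) (rotate1 (xs @ ys))) = set (zip (ys @ xs) (rotate1 (ys @ xs)))"
    for xs ys :: "'a list"
  proof (induction xs arbitrary: ys)
    case (Cons x xs)
    have step: "set (zip (z # zs) (rotate1 (z # zs)))
        = set (zip (zs @ [z]) (rotate1 (zs @ [z])))" for z :: 'a and zs
    proof (cases zs)
      case (Cons a as)
      have "zip (a # as @ [z]) (as @ [z, a]) = zip (a # as) (as @ [z]) @ [(z, a)]"
        using zip_append[of "a # as" "as @ [z]" "[z]" "[a]"] by simp
      then show ?thesis using Cons by auto
    qed simp
    show ?case using step[of x "xs @ ys"] Cons.IH[of "ys @ [x]"] by simp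
  qed simp
  then show ?thesis by (simp add: cycle_edges_def)
qed

lemma cycle_edges_subset: "cycle_edges xs \<subseteq> set xs \<times> set xs"
  by (auto simp: cycle_edges_def dest: set_zip_leftD set_zip_rightD)

lemma successively_cycle_edges: "successively (\<lambda>u v. (u, v) \<in> cycle_edges xs) xs"
proof -
  have "(xs ! i, xs ! Suc i) \<in> set (zip xs (rotate1 xs))" if "Suc i < length xs" for i
    using that nth_rotate1[of i xs] by (auto simp: in_set_zip intro!: exI[of _ i])
  then show ?thesis by (auto simp: cycle_edges_def successively_conv_nth)
qed

lemma cycle_edges_neighbours:
  assumes "is_cycle xs" "u \<in> set xs"
  obtains a b where "a \<noteq> b" "adj u a" "adj u b" "{w. (u, w) \<in> cycle_edges xs} = {a, b}"
proof -
  obtain us vs where xs: "xs = us @ u # vs" using assms(2) split_list by fastforce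
  then have cyc: "is_cycle (u # vs @ us)" using assms(1) is_cycle_rotate[of us "u # vs"] by simp
  have edges: "cycle_edges xs = cycle_edges (u # vs @ us)"
    using xs cycle_edges_rotate[of us "u # vs"] by simp
  obtain a zs b where ws: "vs @ us = a # zs @ [b]"
    using cyc by (cases "vs @ us"; cases "tl (vs @ us)" rule: rev_cases) (auto simp: is_cycle_def)
  have fresh: "u \<noteq> a" "u \<noteq> b" "u \<notin> set zs" using cyc ws by (auto simp: is_cycle_def)
  \<comment> \<open>After rotating \<open>u\<close> to the front, it occurs in the pairs \<open>(u, a)\<close> and \<open>(b, u)\<close> only.\<close>
  have "zip (a # zs @ [b]) (zs @ [b, u]) = zip (a # zs) (zs @ [b]) @ [(b, u)]"
    using zip_append[of "a # zs" "zs @ [b]" "[b]" "[u]"] by simp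
  then have "{w. (u, w) \<in> cycle_edges xs} = {a, b}"
    using fresh unfolding edges unfolding ws cycle_edges_def
    by (auto dest: set_zip_leftD set_zip_rightD)
  moreover have "a \<noteq> b" "adj u a" "adj u b"
    using cyc ws adj_sym by (auto simp: is_cycle_def)
  ultimately show ?thesis using that by blast
qed

end

section \<open>Claw-free graphs and cycles that cannot be enlarged\<close>

locale claw_free_adjacency = adjacency +
  assumes no_claw: "\<lbrakk>adj x a; adj x b; adj x c; a \<noteq> b; a \<noteq> c; b \<noteq> c\<rbrakk>
      \<Longrightarrow> adj a b \<or> adj a c \<or> adj b c"

locale nonextendable = claw_free_adjacency adj
  for adj :: "'a \<Rightarrow> 'a \<Rightarrow> bool" +
  fixes V A :: "'a set"
  assumes fin: "finite V" and A_sub: "A \<subseteq> V"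
    and nonext: "s \<in> V - A \<Longrightarrow> \<not> has_hamiltonian_cycle (insert s A)"
begin

text \<open>
  Being an exit depends on \<open>A\<close> alone and not on a cycle, so the exits stay the same while the
  Hamiltonian cycle of \<open>A\<close> is rearranged.
\<close>

definition exits :: "'a set" where
  "exits = {x \<in> A. \<exists>s\<in>V - A. adj x s}"

abbreviation hamiltonian :: "'a list \<Rightarrow> bool" where
  "hamiltonian xs \<equiv> is_cycle xs \<and> set xs = A"

lemma no_common_outside_neighbour:
  assumes "hamiltonian (p # q # zs)" "s \<in> V - A" "adj s p"
  shows "\<not> adj s q"
proof
  assume "adj s q"
  then have "is_cycle (p # s # q # zs)" using assms by (intro is_cycle_insert) auto
  moreover have "set (p # s # q # zs) = insert s A" using assms by auto
  ultimately show False using nonext[OF assms(2)] unfolding has_hamiltonian_cycle_def by blast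
qed

text \<open>
  An outside neighbour \<open>s\<close> of \<open>x\<close> is adjacent to neither cycle neighbour of \<open>x\<close>. These two and \<open>s\<close>
  would be the leaves of a claw centred at \<open>x\<close> unless the two were adjacent.
\<close>

lemma exit_neighbours_adjacent:
  assumes "hamiltonian (x # ys)" "x \<in> exits"
  shows "adj (last ys) (hd ys)"
proof -
  obtain s where s: "s \<in> V - A" "adj x s" using assms by (auto simp: exits_def)
  obtain b zs where ys: "ys = b # zs" "zs \<noteq> []" "last zs \<noteq> b"
    using assms(1) unfolding is_cycle_def
    by (cases ys; cases "tl ys") (auto dest!: last_in_set split: if_splits)
  let ?a = "last zs"
  have ham: "hamiltonian (x # b # zs)" using assms ys by simp
  have "is_cycle ((x # b # butlast zs) @ [?a])" using ham ys by simp
  then have "is_cycle (?a # x # b # butlast zs)" using is_cycle_rotate by fastforce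
  moreover have "set (?a # x # b # butlast zs) = A"
    using ham ys(2) by (metis (no_types, opaque_lifting) append_butlast_last_id insert_commute
        list.simps(15) rotate1.simps(2) set_rotate1)
  ultimately have ham': "hamiltonian (?a # x # b # butlast zs)" by blast
  have "\<not> adj s b" using no_common_outside_neighbour[OF ham s(1)] s adj_sym by blast
  moreover have "\<not> adj s ?a"
    using no_common_outside_neighbour[OF ham' s(1)] s adj_sym by blast
  moreover have "adj x b" "adj x ?a"
    using ham ys adj_sym by (auto simp: is_cycle_def)
  moreover have "s \<noteq> b" "s \<noteq> ?a" using s ham ys(2) by auto
  ultimately have "adj ?a b" using no_claw[of x ?a b s] s ys(3) adj_sym by blast
  then show ?thesis using ys by simp
qed

text \<open>
  With \<open>a, c, b, b'\<close> consecutive on the cycle, \<open>a\<close> is adjacent to \<open>b\<close> because \<open>c\<close> is an exit, and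
  \<open>c\<close> is adjacent to \<open>b'\<close> because \<open>b\<close> is an exit. So \<open>a, b, c, b'\<close> is possible as well.
\<close>

lemma swap_exits:
  assumes "hamiltonian (c # b # rest)" "rest \<noteq> []" "c \<in> exits" "b \<in> exits"
  shows "hamiltonian (b # c # rest)"
proof -
  have "adj (last rest) b"
    using exit_neighbours_adjacent[OF assms(1,3)] assms(2) by simp
  moreover have "hamiltonian (b # rest @ [c])"
    using assms(1) is_cycle_rotate[of "[c]" "b # rest"] by auto
  then have "adj c (hd rest)"
    using exit_neighbours_adjacent[of b "rest @ [c]"] assms(2,4) by simp
  ultimately show ?thesis
    using assms(1,2) adj_sym by (auto simp: is_cycle_def successively_Cons)
qed

lemma slide_exit:
  assumes "hamiltonian (c # zs @ rest)" "rest \<noteq> []" "c \<in> exits" "set zs \<subseteq> exits"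
  shows "hamiltonian (zs @ c # rest)"
  using assms
proof (induction zs arbitrary: rest)
  case Nil
  then show ?case by simp
next
  case (Cons z zs)
  have "hamiltonian (z # c # zs @ rest)"
    using swap_exits[of c z "zs @ rest"] Cons.prems by auto
  then have "hamiltonian (c # zs @ rest @ [z])"
    using is_cycle_rotate[of "[z]" "c # zs @ rest"] by auto
  then have "hamiltonian (zs @ c # rest @ [z])"
    using Cons.IH[of "rest @ [z]"] Cons.prems by auto
  then show ?case
    using is_cycle_rotate[of "zs @ c # rest" "[z]"] by auto
qed

text \<open>
  The neighbours of \<open>d\<close> are treated one after the other along the cycle: \<open>ps\<close> is the finished
  part, in which every neighbour of \<open>d\<close> is followed by a vertex that is not an exit, and \<open>ws\<close> is
  still to be scanned. That \<open>ps\<close> begins with a neighbour of \<open>d\<close> stops the last sliding vertex from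
  running past the point where the scan began. The last vertex of the resulting list is not a
  neighbour of \<open>d\<close>, so the closing edge of the cycle need not be considered.
\<close>

lemma arrange_successors:
  assumes d: "d \<in> V - A" and C: "C = {c \<in> A. adj d c}"
    and "hamiltonian (ps @ ws)" "ps \<noteq> []" "hd ps \<in> C"
    "successively (\<lambda>x y. x \<in> C \<longrightarrow> y \<notin> exits) ps" "last ps \<notin> C"
  shows "\<exists>xs. hamiltonian xs \<and> successively (\<lambda>x y. x \<in> C \<longrightarrow> y \<notin> exits) xs \<and> last xs \<notin> C"
  using assms(3-)
proof (induction "length ws" arbitrary: ps ws rule: less_induct)
  case less
  have C_exits: "C \<subseteq> exits" using d C adj_sym by (auto simp: exits_def)
  have apart: False if "hamiltonian (p # q # zs)" "p \<in> C" "q \<in> C" for p q zs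
    using no_common_outside_neighbour[OF that(1) d] that C by blast
  show ?case
  proof (cases ws)
    case Nil
    then show ?thesis using less.prems by auto
  next
    case (Cons w ws')
    show ?thesis
    proof (cases "w \<in> C")
      case False
      show ?thesis
        using less.hyps[of ws' "ps @ [w]"] less.prems False Cons
        by (auto simp: successively_append_iff)
    next
      case True
      have ham: "hamiltonian (w # ws' @ ps)"
        using less.prems(1) is_cycle_rotate[of ps ws] Cons by auto
      \<comment> \<open>Otherwise \<open>w\<close> would slide all the way round to the neighbour of \<open>d\<close> that begins \<open>ps\<close>.\<close>
      have "\<exists>y\<in>set ws'. y \<in> C \<or> y \<notin> exits"
      proof (rule ccontr)
        assume "\<not> ?thesis"
        then have "hamiltonian (ws' @ w # ps)"
          using slide_exit[OF ham less.prems(2)] True C_exits by blast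
        then have "hamiltonian (w # ps @ ws')"
          using is_cycle_rotate[of ws' "w # ps"] by auto
        then show False
          using apart[of w "hd ps" "tl ps @ ws'"] less.prems(2,3) True by (cases ps) auto
      qed
      then obtain zs y rest where ws': "ws' = zs @ y # rest" "y \<in> C \<or> y \<notin> exits"
          "\<forall>z\<in>set zs. \<not> (z \<in> C \<or> z \<notin> exits)"
        using split_list_first_prop[of ws' "\<lambda>y. y \<in> C \<or> y \<notin> exits"] by blast
      then have slid: "hamiltonian (zs @ w # y # rest @ ps)"
        using slide_exit[of w zs "y # rest @ ps"] ham True C_exits by auto
      have "hamiltonian (w # y # rest @ ps @ zs)"
        using slid is_cycle_rotate[of zs "w # y # rest @ ps"] by auto
      then have y: "y \<notin> exits" using apart ws' True by blast
      have "hamiltonian ((ps @ zs @ [w, y]) @ rest)"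
        using slid is_cycle_rotate[of "zs @ w # y # rest" ps] by auto
      moreover have "successively (\<lambda>x y. x \<in> C \<longrightarrow> y \<notin> exits) zs"
        using ws'(3) by (auto simp: successively_conv_nth)
      then have "successively (\<lambda>x y. x \<in> C \<longrightarrow> y \<notin> exits) (ps @ zs @ [w, y])"
        using less.prems y ws' by (auto simp: successively_append_iff)
      ultimately show ?thesis
        using less.hyps[of rest "ps @ zs @ [w, y]"] less.prems y C_exits Cons ws' by auto
    qed
  qed
qed

lemma successors_not_adjacent:
  assumes "hamiltonian xs" and d: "d \<in> V - A"
    and "i < j" "Suc i \<noteq> j" "Suc j < length xs" "adj d (xs ! i)" "adj d (xs ! j)"
  shows "\<not> adj (xs ! Suc i) (xs ! Suc j)"
proof
  assume cross: "adj (xs ! Suc i) (xs ! Suc j)"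
  define ys where "ys = take (j - Suc i) (drop (Suc i) xs)"
  define ys' where "ys' = drop (Suc j) xs @ take i xs"
  have "xs = take i xs @ xs ! i # drop (Suc i) xs"
    using assms by (intro id_take_nth_drop) auto
  also have "drop (Suc i) xs = ys @ xs ! j # drop (Suc j) xs"
    using assms id_take_nth_drop[of "j - Suc i" "drop (Suc i) xs"] unfolding ys_def by auto
  finally have xs: "xs = take i xs @ (xs ! i # ys @ xs ! j # drop (Suc j) xs)" by simp
  then have "is_cycle ((xs ! i # ys @ xs ! j # drop (Suc j) xs) @ take i xs)"
    using is_cycle_rotate assms(1) by metis
  then have cyc: "is_cycle (xs ! i # ys @ xs ! j # ys')" by (simp add: ys'_def)
  have "set xs = set (take i xs @ (xs ! i # ys @ xs ! j # drop (Suc j) xs))"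
    using xs by simp
  then have set: "set (xs ! i # ys @ xs ! j # ys') = A"
    using assms(1) by (auto simp: ys'_def)
  have "ys \<noteq> []" "ys' \<noteq> []" "hd ys = xs ! Suc i" "hd ys' = xs ! Suc j"
    using assms by (auto simp: ys_def ys'_def hd_append hd_drop_conv_nth hd_take)
  then have "is_cycle (d # xs ! i # rev ys' @ ys @ [xs ! j])"
    using crossing_cycle[OF cyc] cross assms set by auto
  moreover have "set (d # xs ! i # rev ys' @ ys @ [xs ! j]) = insert d A"
    using set by auto
  ultimately show False using nonext[OF d] unfolding has_hamiltonian_cycle_def by blast
qed

text \<open>
  The independent set consists of the successors of the neighbours of \<open>d\<close> on a rearranged cycle.
  At least two neighbours of \<open>d\<close> are required: a single one might slide round the whole cycle
  without ever meeting a vertex that is not an exit.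
\<close>

lemma independent_successors:
  assumes A: "has_hamiltonian_cycle A" and d: "d \<in> V - A"
    and C: "C = {c \<in> A. adj d c}" and two: "2 \<le> card C"
  shows "\<exists>Y \<subseteq> A - exits. card Y = card C \<and> indep Y"
proof -
  have C_exits: "C \<subseteq> exits" using d C adj_sym by (auto simp: exits_def)
  have apart: False if "hamiltonian (p # q # zs)" "p \<in> C" "q \<in> C" for p q zs
    using no_common_outside_neighbour[OF that(1) d] that C by blast
  obtain c c' where cc: "c \<in> C" "c' \<in> C" "c \<noteq> c'"
    using two by (metis One_nat_def Suc_1 card_le_Suc0_iff_eq card.infinite not_less_eq_eq
        le_zero_eq nat.simps(3))
  obtain xs0 where "hamiltonian xs0" using A unfolding has_hamiltonian_cycle_def by blast
  moreover obtain us vs where "xs0 = us @ c # vs"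
    using calculation cc(1) C by (metis (no_types, lifting) mem_Collect_eq split_list)
  ultimately have ham: "hamiltonian (c # vs @ us)"
    using is_cycle_rotate[of us "c # vs"] by auto
  then have "c' \<in> set (vs @ us)" using cc C by auto
  \<comment> \<open>Treating \<open>c\<close> first provides the nonempty finished part \<open>[c, y]\<close> from which the scan starts.\<close>
  then obtain zs y rest where ws: "vs @ us = zs @ y # rest" "y \<in> C \<or> y \<notin> exits"
      "\<forall>z\<in>set zs. \<not> (z \<in> C \<or> z \<notin> exits)"
    using split_list_first_prop[of "vs @ us" "\<lambda>y. y \<in> C \<or> y \<notin> exits"] cc(2) by blast
  then have "hamiltonian (zs @ c # y # rest)"
    using slide_exit[of c zs "y # rest"] ham cc(1) C_exits by auto
  then have ham': "hamiltonian ([c, y] @ rest @ zs)"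
    using is_cycle_rotate[of zs "c # y # rest"] by auto
  then have "y \<notin> exits" using apart[of c y "rest @ zs"] ws(2) cc(1) by auto
  then obtain xs where xs: "hamiltonian xs"
      "successively (\<lambda>x y. x \<in> C \<longrightarrow> y \<notin> exits) xs" "last xs \<notin> C"
    using arrange_successors[OF d C ham'] cc(1) C_exits by auto
  have dist: "distinct xs" and ne: "xs \<noteq> []" using xs(1) by (auto simp: is_cycle_def)
  define I where "I = {i. i < length xs \<and> xs ! i \<in> C}"
  have not_last: "Suc i < length xs" if "i \<in> I" for i
    using that xs(3) ne unfolding I_def
    by (metis (mono_tags, lifting) Suc_lessI diff_Suc_1 last_conv_nth mem_Collect_eq)
  have succ: "xs ! Suc i \<notin> exits" if "i \<in> I" for i
    using that not_last[OF that] xs(2) unfolding I_def successively_conv_nth by auto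
  have "(!) xs ` I = C" using xs(1) C by (auto simp: I_def set_conv_nth)
  moreover have "inj_on ((!) xs) I" using dist by (auto simp: I_def inj_on_def nth_eq_iff_index_eq)
  ultimately have card_I: "card I = card C" using card_image by metis
  define Y where "Y = (\<lambda>i. xs ! Suc i) ` I"
  have "inj_on (\<lambda>i. xs ! Suc i) I"
    using dist not_last by (auto simp: inj_on_def nth_eq_iff_index_eq)
  then have "card Y = card C" using card_I card_image unfolding Y_def by metis
  moreover have "Y \<subseteq> A - exits"
    using succ not_last xs(1) nth_mem unfolding Y_def by blast
  moreover have nadj: "\<not> adj (xs ! Suc i) (xs ! Suc j)" if "i \<in> I" "j \<in> I" "i < j" for i j
  proof (rule successors_not_adjacent[OF xs(1) d that(3)])
    show "Suc i \<noteq> j" using succ[OF that(1)] that(2) C_exits by (auto simp: I_def)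
  qed (use that not_last C in \<open>auto simp: I_def\<close>)
  have "indep Y"
    unfolding indep_def Y_def using nadj adj_sym adj_irrefl by (auto) (metis linorder_neqE_nat)
  ultimately show ?thesis by blast
qed

text \<open>
  The independent successors are not exits, so they can be added to any independent subset of
  \<open>V - A\<close>. The gain equals the degree that \<open>d\<close> loses when \<open>A\<close> is removed.
\<close>

lemma alpha_drop:
  assumes A: "has_hamiltonian_cycle A" and d: "d \<in> V - A"
    and two: "2 \<le> card {c \<in> A. adj d c}"
  shows "alpha (V - A) + card {c \<in> A. adj d c} \<le> alpha V"
proof -
  obtain Y where Y: "Y \<subseteq> A - exits" "card Y = card {c \<in> A. adj d c}" "indep Y"
    using independent_successors[OF A d refl two] by blast
  obtain I where I: "I \<subseteq> V - A" "indep I" "card I = alpha (V - A)"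
    using alpha_attained[of "V - A"] fin by auto
  have "\<not> adj y s" if "y \<in> Y" "s \<in> I" for y s
    using that Y I by (auto simp: exits_def)
  then have "\<not> adj y s" "\<not> adj s y" if "y \<in> Y" "s \<in> I" for y s
    using that adj_sym by blast+
  then have "indep (I \<union> Y)" using Y I by (auto simp: indep_def)
  then have "card (I \<union> Y) \<le> alpha V"
    using card_le_alpha[OF fin] I Y A_sub by blast
  moreover have "card (I \<union> Y) = card I + card Y"
    using I Y A_sub fin by (intro card_Un_disjoint) (auto intro: finite_subset)
  ultimately show ?thesis using I Y by simp
qed

end

section \<open>Peeling off cycles\<close>

context claw_free_adjacency
begin

text \<open>
  Induction on the number of vertices. Removing \<open>A\<close> lowers \<open>\<alpha>\<close> by at least the number of
  neighbours in \<open>A\<close> of any remaining vertex, and by at least 1 in any case; the former preserves the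
  degree hypothesis, the latter pays for the cycle on \<open>A\<close>.
\<close>

theorem cycle_partition:
  assumes "finite V" "\<And>v. v \<in> V \<Longrightarrow> alpha V < card {u \<in> V. adj v u}"
  shows "\<exists>\<P>. partition_on V \<P> \<and> card \<P> \<le> alpha V \<and> (\<forall>A\<in>\<P>. has_hamiltonian_cycle A)"
  using assms
proof (induction "card V" arbitrary: V rule: less_induct)
  case less
  note fin = \<open>finite V\<close>
  show ?case
  proof (cases "V = {}")
    case True
    then show ?thesis by (intro exI[of _ "{}"]) (auto simp: partition_on_def)
  next
    case False
    have two: "2 \<le> card {u \<in> V. adj v u}" if "v \<in> V" for v
    proof -
      have "card {v} \<le> alpha V"
        using that adj_irrefl by (intro card_le_alpha[OF fin]) (auto simp: indep_def)
      then show ?thesis using less.prems(2)[OF that] by simp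
    qed
    obtain u xs where u: "is_cycle xs" "set xs \<subseteq> V" "u \<in> set xs" "{w \<in> V. adj u w} \<subseteq> set xs"
      using cycle_around_neighbourhood[OF fin False two] by blast
    let ?P = "\<lambda>A. has_hamiltonian_cycle A \<and> A \<subseteq> V \<and> u \<in> A \<and> {w \<in> V. adj u w} \<subseteq> A"
    have "?P (set xs)" using u unfolding has_hamiltonian_cycle_def by blast
    moreover have "\<forall>A. ?P A \<longrightarrow> card A < Suc (card V)"
      using card_mono[OF fin] le_imp_less_Suc by blast
    ultimately obtain A where A: "?P A" and maxi: "\<forall>B. ?P B \<longrightarrow> card B \<le> card A"
      using ex_has_greatest_nat[of ?P "set xs" card "Suc (card V)"] by blast
    have finA: "finite A" using A fin finite_subset by blast
    interpret nonextendable adj V A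
    proof
      show "\<not> has_hamiltonian_cycle (insert s A)" if s: "s \<in> V - A" for s
      proof
        assume "has_hamiltonian_cycle (insert s A)"
        then have "card (insert s A) \<le> card A" using maxi A s by blast
        then show False using s finA by simp
      qed
    qed (use A fin in auto)
    \<comment> \<open>All neighbours of \<open>u\<close> are in \<open>A\<close>, so \<open>u\<close> extends every independent subset of \<open>V - A\<close>.\<close>
    have drop1: "alpha (V - A) + 1 \<le> alpha V"
    proof -
      obtain I where I: "I \<subseteq> V - A" "indep I" "card I = alpha (V - A)"
        using alpha_attained[of "V - A"] fin by auto
      have "\<not> adj u s" "\<not> adj s u" if "s \<in> I" for s
        using that A I adj_sym by blast+
      then have "indep (insert u I)" using I adj_irrefl by (auto simp: indep_def)
      then have "card (insert u I) \<le> alpha V"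
        using card_le_alpha[OF fin] I A by blast
      moreover have "u \<notin> I" "finite I" using I A fin finite_subset by auto
      ultimately show ?thesis using I by simp
    qed
    have "alpha (V - A) < card {w \<in> V - A. adj d w}" if d: "d \<in> V - A" for d
    proof -
      let ?m = "card {c \<in> A. adj d c}"
      have "{w \<in> V. adj d w} = {w \<in> V - A. adj d w} \<union> {c \<in> A. adj d c}" using A by blast
      then have "card {w \<in> V. adj d w} = card {w \<in> V - A. adj d w} + ?m"
        using fin finA card_Un_disjoint[of "{w \<in> V - A. adj d w}" "{c \<in> A. adj d c}"] by auto
      moreover have "alpha V < card {w \<in> V. adj d w}" using less.prems(2) d by blast
      moreover have "alpha (V - A) + ?m \<le> alpha V"
        using alpha_drop[OF _ d] A drop1 by (cases "2 \<le> ?m") auto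
      ultimately show ?thesis by linarith
    qed
    moreover have "card (V - A) < card V" using A fin by (intro psubset_card_mono) auto
    ultimately obtain \<P> where \<P>: "partition_on (V - A) \<P>" "card \<P> \<le> alpha (V - A)"
        "\<forall>B\<in>\<P>. has_hamiltonian_cycle B"
      using less.hyps[of "V - A"] fin by auto
    have "partition_on V (insert A \<P>)"
      using \<P>(1) A by (auto simp: partition_on_def disjoint_def)
    moreover have "card (insert A \<P>) \<le> alpha V"
      using \<P>(2) drop1 card_insert_le_m1[of "alpha V" \<P> A] by (auto simp: card_insert_if)
    ultimately show ?thesis using \<P>(3) A by blast
  qed
qed

end

section \<open>Translation to symmetric digraphs\<close>

lemma (in graph) out_degree_eq_card_neighbours:
  "out_degree G v = card {w. v \<rightarrow>\<^bsub>G\<^esub> w}"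
proof -
  have "head G ` out_arcs G v = {w. v \<rightarrow>\<^bsub>G\<^esub> w}"
    by (auto simp: out_arcs_def arcs_ends_conv)
  moreover have "inj_on (head G) (out_arcs G v)"
    using no_multi_arcs by (auto simp: inj_on_def out_arcs_def arc_to_ends_def)
  ultimately show ?thesis unfolding out_degree_def using card_image by metis
qed

lemma (in graph) adjacency_dominates: "adjacency (dominates G)"
  using sym_arcs adj_not_same by unfold_locales (auto simp: symmetric_def dest: symD)

text \<open>
  The centre and the leaves of a claw of the relation induce a \<open>K\<^bsub>1,3\<^esub>\<close>.
\<close>

lemma (in graph) claw_free_adjacency_dominates:
  assumes "claw_free G"
  shows "claw_free_adjacency (dominates G)"
proof -
  interpret adjacency "dominates G" by (rule adjacency_dominates)
  show ?thesis
  proof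
    fix x a b c
    assume star: "x \<rightarrow>\<^bsub>G\<^esub> a" "x \<rightarrow>\<^bsub>G\<^esub> b" "x \<rightarrow>\<^bsub>G\<^esub> c" and distinct: "a \<noteq> b" "a \<noteq> c" "b \<noteq> c"
    show "a \<rightarrow>\<^bsub>G\<^esub> b \<or> a \<rightarrow>\<^bsub>G\<^esub> c \<or> b \<rightarrow>\<^bsub>G\<^esub> c"
    proof (rule ccontr)
      assume none: "\<not> ?thesis"
      let ?S = "{x, a, b, c}"
      have ind: "induced_subgraph (G \<restriction> ?S) G"
        using star adj_in_verts by (intro induced_induce) auto
      then have "digraph (G \<restriction> ?S)" by (intro digraph_subgraph) (auto simp: induced_subgraph_def)
      then have graph: "graph (G \<restriction> ?S)"
        using induced_graph_imp_graph[OF ind] by (intro digraph.graphI sym_digraph.sym_arcs)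
      have "arcs_ends (G \<restriction> ?S) = arcs_ends G \<inter> ?S \<times> ?S"
        by (auto simp: arcs_ends_conv)
      moreover have "a \<rightarrow>\<^bsub>G\<^esub> x" "b \<rightarrow>\<^bsub>G\<^esub> x" "c \<rightarrow>\<^bsub>G\<^esub> x" using star adj_sym by blast+
      moreover have "\<not> a \<rightarrow>\<^bsub>G\<^esub> b" "\<not> a \<rightarrow>\<^bsub>G\<^esub> c" "\<not> b \<rightarrow>\<^bsub>G\<^esub> c" "\<not> b \<rightarrow>\<^bsub>G\<^esub> a" "\<not> c \<rightarrow>\<^bsub>G\<^esub> a" "\<not> c \<rightarrow>\<^bsub>G\<^esub> b"
        using none adj_sym by blast+
      ultimately have "arcs_ends (G \<restriction> ?S) = {x} \<times> {a, b, c} \<union> {a, b, c} \<times> {x}"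
        using star adj_irrefl by auto
      moreover have "verts (G \<restriction> ?S) = {x} \<union> {a, b, c}" "{x} \<inter> {a, b, c} = {}"
          "card {x} = 1" "card {a, b, c} = 3"
        using distinct star adj_irrefl by auto
      ultimately have "K\<^bsub>1,3\<^esub> (G \<restriction> ?S)"
        unfolding complete_bipartite_digraph_def using graph by blast
      then show False using ind assms unfolding claw_free_def by blast
    qed
  qed
qed

lemma (in sym_digraph) scc_of_eq_on_path:
  assumes "successively (dominates G) xs" "u \<in> set xs" "v \<in> set xs"
  shows "scc_of u = scc_of v"
proof -
  have "scc_of w = scc_of (hd xs)" if "w \<in> set xs" for w
    using assms(1) that
  proof (induction xs arbitrary: w)
    case (Cons x xs)
    show ?case
    proof (cases "w = x")
      case False
      then have "w \<in> set xs" and "x \<rightarrow>\<^bsub>G\<^esub> hd xs" "successively (dominates G) xs"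
        using Cons.prems by (auto simp: successively_Cons)
      moreover have "scc_of x = scc_of (hd xs)"
        by (rule scc_of_eq[OF scc_ofI_reachable[OF reachable_adjI]]) fact
      ultimately show ?thesis using Cons.IH by simp
    qed simp
  qed simp
  from this[OF assms(2)] this[OF assms(3)] show ?thesis by simp
qed

text \<open>
  The 2-factor keeps the arcs of \<open>G\<close> that run along the chosen cycles. Every chosen cycle lies in one
  of its components and every vertex lies on a chosen cycle, so it has at most as many components
  as there are cycles.
\<close>

lemma (in graph) two_factor_from_cycle_partition:
  assumes part: "partition_on (verts G) \<P>"
    and ham: "\<forall>A\<in>\<P>. adjacency.has_hamiltonian_cycle (dominates G) A"
  shows "\<exists>F. two_factor F G \<and> card (components F) \<le> card \<P>"
proof -
  interpret adjacency "dominates G" by (rule adjacency_dominates)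
  obtain L where L: "\<And>A. A \<in> \<P> \<Longrightarrow> is_cycle (L A) \<and> set (L A) = A"
    using ham unfolding has_hamiltonian_cycle_def by metis
  define E where "E = (\<Union>A\<in>\<P>. cycle_edges (L A))"
  define F where "F = G\<lparr>arcs := {e \<in> arcs G. (tail G e, head G e) \<in> E}\<rparr>"
  have F_simps: "verts F = verts G" "arcs F = {e \<in> arcs G. (tail G e, head G e) \<in> E}"
      "tail F = tail G" "head F = head G" by (auto simp: F_def)
  have edges_at: "{w. (v, w) \<in> E} = {w. (v, w) \<in> cycle_edges (L A)}" if "A \<in> \<P>" "v \<in> A" for v A
  proof -
    have "B = A" if "B \<in> \<P>" "(v, w) \<in> cycle_edges (L B)" for B w
    proof -
      have "v \<in> B" using that L[OF that(1)] cycle_edges_subset by blast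
      then show ?thesis
        using disjointD[OF partition_onD2[OF part] \<open>A \<in> \<P>\<close> that(1)] \<open>v \<in> A\<close> by blast
    qed
    then show ?thesis using \<open>A \<in> \<P>\<close> unfolding E_def by blast
  qed
  have E_verts: "\<exists>A\<in>\<P>. v \<in> A" if "(v, w) \<in> E" for v w
    using that L cycle_edges_subset unfolding E_def by fastforce
  have nbrs: "\<exists>a b. a \<noteq> b \<and> v \<rightarrow>\<^bsub>G\<^esub> a \<and> v \<rightarrow>\<^bsub>G\<^esub> b \<and> {w. (v, w) \<in> E} = {a, b}"
    if "A \<in> \<P>" "v \<in> A" for v A
    using cycle_edges_neighbours[of "L A" v] L that edges_at[OF that] by metis
  have "E \<subseteq> arcs_ends G"
  proof (rule subrelI)
    fix v w assume vw: "(v, w) \<in> E"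
    then obtain a b where "v \<rightarrow>\<^bsub>G\<^esub> a" "v \<rightarrow>\<^bsub>G\<^esub> b" "{w. (v, w) \<in> E} = {a, b}"
      using E_verts[OF vw] nbrs by metis
    moreover have "w \<in> {w. (v, w) \<in> E}" using vw by simp
    ultimately show "v \<rightarrow>\<^bsub>G\<^esub> w" by auto
  qed
  then have ends: "arcs_ends F = E" by (auto simp: arcs_ends_conv F_simps)
  have wf: "wf_digraph F" by unfold_locales (auto simp: F_simps)
  have sub: "subgraph F G"
    using wf wf_digraph by (auto simp: subgraph_def compatible_def F_simps)
  have "symmetric F"
    using cycle_edges_sym unfolding symmetric_def ends E_def by (auto simp: sym_def)
  then have graph_F: "graph F" using digraph_subgraph[OF sub] by (intro digraph.graphI)
  interpret F: graph F by (rule graph_F)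
  have "out_degree F v = 2" if v: "v \<in> verts F" for v
  proof -
    obtain A where "A \<in> \<P>" "v \<in> A" using v partition_onD1[OF part] F_simps by auto
    then obtain a b where "a \<noteq> b" "{w. (v, w) \<in> E} = {a, b}" using nbrs by blast
    then show ?thesis by (simp add: F.out_degree_eq_card_neighbours ends)
  qed
  then have two: "two_factor F G"
    using graph_F sub by (auto simp: two_factor_def regular_def spanning_def F_simps)
  have fin: "finite \<P>" using finite_elements[OF finite_verts part] .
  have scc: "F.scc_of v = F.scc_of (hd (L A))" if A: "A \<in> \<P>" and v: "v \<in> A" for v A
  proof (rule F.scc_of_eq_on_path[of "L A"])
    have cyc: "is_cycle (L A)" and set: "set (L A) = A" using L[OF A] by blast+
    show "successively (dominates F) (L A)"
      by (rule successively_mono[OF successively_cycle_edges]) (use A in \<open>auto simp: ends E_def\<close>)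
    have "L A \<noteq> []" using cyc by (auto simp: is_cycle_def)
    then show "hd (L A) \<in> set (L A)" by (rule hd_in_set)
    show "v \<in> set (L A)" unfolding set by (rule v)
  qed
  have "F.sccs_verts \<subseteq> (\<lambda>A. F.scc_of (hd (L A))) ` \<P>"
  proof
    fix S assume "S \<in> F.sccs_verts"
    then obtain v where "v \<in> verts G" "S = F.scc_of v"
      unfolding F.sccs_verts_conv_scc_of F_simps by blast
    moreover then obtain A where "A \<in> \<P>" "v \<in> A" using partition_onD1[OF part] by blast
    ultimately show "S \<in> (\<lambda>A. F.scc_of (hd (L A))) ` \<P>" using scc by blast
  qed
  then have "card F.sccs_verts \<le> card \<P>"
    by (rule surj_card_le[OF fin])
  then have "card (components F) \<le> card \<P>"
    using components_eq_sccs[OF graph_F] F.card_sccs_verts by simp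
  then show ?thesis using two by blast
qed

theorem corollary9:
  fixes G :: "('a, 'b) pre_digraph"
  assumes "graph G"
    and "claw_free G"
    and "min_degree G \<ge> independence_number G + 1"
  shows "\<exists>F. two_factor F G \<and> card (components F) \<le> independence_number G"
proof -
  interpret graph G by fact
  interpret claw_free_adjacency "dominates G"
    using claw_free_adjacency_dominates assms(2) .
  have alpha: "independence_number G = alpha (verts G)"
    by (simp add: independence_number_def alpha_def independent_set_def indep_def)
  have "alpha (verts G) < card {u \<in> verts G. v \<rightarrow>\<^bsub>G\<^esub> u}" if "v \<in> verts G" for v
  proof -
    have "min_degree G \<le> out_degree G v"
      using that unfolding min_degree_def by (intro Min_le) auto
    moreover have "{u \<in> verts G. v \<rightarrow>\<^bsub>G\<^esub> u} = {u. v \<rightarrow>\<^bsub>G\<^esub> u}" using adj_in_verts by blast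
    ultimately show ?thesis
      using assms(3) alpha out_degree_eq_card_neighbours[of v] by simp
  qed
  then obtain \<P> where "partition_on (verts G) \<P>" "card \<P> \<le> alpha (verts G)"
      "\<forall>A\<in>\<P>. has_hamiltonian_cycle A"
    using cycle_partition[OF finite_verts] by blast
  then show ?thesis
    using two_factor_from_cycle_partition alpha by (metis le_trans)
qed

end
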